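(* Let $\Theta=[0,1]$ and let Assumptions 1–4 hold. If $|\Gamma^\star_a|\le2$ for all $a\in A$ (the contact set is pairwise) and full disclosure is optimal, then full disclosure is the unique optimal outcome.
   Context: Setting. $A=[0,1]$ is the set of actions and $\overline\Theta=[0,1]$ the set of states. For a compact metric space $X$, $\Delta(X)$ is the set of Borel probability measures on $X$ (weak* topology) and $\operatorname{supp}(\eta)$ is the smallest compact set of $\eta$-measure one. The prior is $\phi\in\Delta(\overline\Theta)$, with support $\Theta=\operatorname{supp}(\phi)$. The sender's and receiver's utilities are $V,U:A\times\overline\Theta\to\mathbb R$. $\delta_\theta$ is the Dirac measure at $\theta$. Assumption 1: $V(a,\theta)$ and $U(a,\theta)$ are differentiable in $a$; $v=\partial V/\partial a$ and $u=\partial U/\partial a$ are continuous in $(a,\theta)$; $u$ is differentiable in $a$ and $u_a=\partial u/\partial a$ is continuous in $(a,\theta)$. Assumption 2 (strict aggregate quasi-concavity): for every $a\in A$ and every $\mu\in\Delta(\Theta)$, $\int u(a,\theta)\,d\mu(\theta)=0$ implies $\int u_a(a,\theta)\,d\mu(\theta)<0$. Assumption 3: $\min_{\theta\in\overline\Theta}u(0,\theta)=\max_{\theta\in\overline\Theta}u(1,\theta)=0$. Assumption 4 (strict single crossing): for all $a\in A$ and $\theta<\theta'$, $u(a,\theta)=0$ implies $u(a,\theta')>0$. Under Assumptions 1–3, for each $\mu\in\Delta(\Theta)$ the receiver's optimal action $a^\star(\mu)$ is unique and is the unique $a$ with $\int u(a,\theta)\,d\mu=0$. Under Assumptions 1–4,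 for each $a\in A$ there is a unique $\theta^\star(a)\in\overline\Theta$ with $u(a,\theta^\star(a))=0$, and $\theta^\star$ is continuous and strictly increasing from $A$ onto $\overline\Theta$. An outcome is $\pi\in\Delta(A\times\Theta)$. It is implementable if (P1) its marginal on $\Theta$ equals $\phi$ and (P2) $\int_{\tilde A\times\Theta}u(a,\theta)\,d\pi(a,\theta)=0$ for every measurable $\tilde A\subset A$. It is optimal if it maximizes $\int V\,d\pi$ over implementable outcomes. The full-disclosure outcome is the image of $\phi$ under $\theta\mapsto(a^\star(\delta_\theta),\theta)$. The dual problem (D) is to choose $p\in C(\Theta)$ and a bounded measurable $q:A\to\mathbb R$ to minimize $\int_\Theta p\,d\phi$ subject to $p(\theta)-q(a)u(a,\theta)\ge V(a,\theta)$ for all $(a,\theta)\in A\times\Theta$. Contact set. Let $p\in C(\Theta)$ be the (unique) solution of (D). Let $\tilde q(a,\theta)=v(a,\theta)/(-u_a(a,\theta))$ if $u(a,\theta)=0$ and $\tilde q(a,\theta)=(V(a^\star(\delta_\theta),\theta)-V(a,\theta))/u(a,\theta)$ if $u(a,\theta)\ne0$, let $C=\max_{A\times\Theta}|\tilde q|$ and $I=[-C,C]$. For $a\in A$ let $Q(a)=\{r\in I:\ p(\theta)\ge V(a,\theta)+r\,u(a,\theta)\text{ for all }\theta\in\Theta\}$ (a nonempty compact interval). Define $q(a)=v(a,\theta^\star(a))/(-u_a(a,\theta^\star(a)))$ if $\theta^\star(a)\in\Theta$ and $p(\theta^\star(a))=V(a,\theta^\star(a))$, and $q(a)=(\min Q(a)+\max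 Q(a))/2$ otherwise. The contact set is $\Gamma=\{(a,\theta)\in A\times\Theta: p(\theta)=V(a,\theta)+q(a)u(a,\theta)\}$, with $a$-sections $\Gamma_a=\{\theta:(a,\theta)\in\Gamma\}$. The set $\Gamma^\star\subset\Gamma$ has $a$-sections $\Gamma^\star_a=\{\theta^\star(a)\}$ if $\Gamma_a\ne\emptyset$ and $\theta^\star(a)\in\{\min\Gamma_a,\max\Gamma_a\}$, and $\Gamma^\star_a=\Gamma_a$ otherwise.
   Formalization: The sender's utility V (and U, unused) is additionally assumed jointly continuous in (a,θ); Assumption 1 only makes v continuous, and with V(0,θ) discontinuous in θ the integrals may be undefined and uniqueness can fail although the contact set is pairwise. *)

theory Defs
  imports "HOL-Probability.Probability"
begin

text \<open>Measurable spaces: A = [0,1] (actions), Theta = [0,1] (states), and A x Theta,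
  all with their Borel sigma-algebras.\<close>

definition Mtheta :: "real measure" where
  "Mtheta = restrict_space borel {0..1}"

definition Mout :: "(real \<times> real) measure" where
  "Mout = restrict_space borel ({0..1} \<times> {0..1})"

definition prob_on :: "'a::topological_space measure \<Rightarrow> 'a set \<Rightarrow> bool" where
  "prob_on M X \<longleftrightarrow> prob_space M \<and> sets M = sets (restrict_space borel X)"

definition supp :: "'a::metric_space measure \<Rightarrow> 'a set" where
  "supp M = \<Inter> {K. compact K \<and> K \<subseteq> space M \<and> K \<in> sets M \<and> emeasure M K = 1}"

text \<open>Receiver's optimal action at belief mu, and the indifference state theta*(a).\<close>
definition a_star :: "(real \<Rightarrow> real \<Rightarrow> real) \<Rightarrow> real measure \<Rightarrow> real" where
  "a_star u \<mu> = (THE a. a \<in> {0..1} \<and> (\<integral>\<theta>. u a \<theta> \<partial>\<mu>) = 0)"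

definition theta_star :: "(real \<Rightarrow> real \<Rightarrow> real) \<Rightarrow> real \<Rightarrow> real" where
  "theta_star u a = (THE \<theta>. \<theta> \<in> {0..1} \<and> u a \<theta> = 0)"

definition full_disclosure :: "(real \<Rightarrow> real \<Rightarrow> real) \<Rightarrow> real measure \<Rightarrow> (real \<times> real) measure" where
  "full_disclosure u \<phi> = distr \<phi> Mout (\<lambda>\<theta>. (a_star u (return Mtheta \<theta>), \<theta>))"

definition implementable :: "(real \<Rightarrow> real \<Rightarrow> real) \<Rightarrow> real measure \<Rightarrow> (real \<times> real) measure \<Rightarrow> bool" where
  "implementable u \<phi> \<pi> \<longleftrightarrow>
     prob_on \<pi> ({0..1} \<times> {0..1}) \<and>
     distr \<pi> Mtheta snd = \<phi> \<and>
     (\<forall>At \<in> sets Mtheta. (\<integral>x\<in>At \<times> {0..1}. u (fst x) (snd x) \<partial>\<pi>) = 0)"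

definition optimal :: "(real \<Rightarrow> real \<Rightarrow> real) \<Rightarrow> (real \<Rightarrow> real \<Rightarrow> real) \<Rightarrow> real measure
    \<Rightarrow> (real \<times> real) measure \<Rightarrow> bool" where
  "optimal V u \<phi> \<pi> \<longleftrightarrow> implementable u \<phi> \<pi> \<and>
     (\<forall>\<pi>'. implementable u \<phi> \<pi>' \<longrightarrow>
        (\<integral>x. V (fst x) (snd x) \<partial>\<pi>') \<le> (\<integral>x. V (fst x) (snd x) \<partial>\<pi>))"

definition dual_feasible :: "(real \<Rightarrow> real \<Rightarrow> real) \<Rightarrow> (real \<Rightarrow> real \<Rightarrow> real)
    \<Rightarrow> (real \<Rightarrow> real) \<Rightarrow> (real \<Rightarrow> real) \<Rightarrow> bool" where
  "dual_feasible V u p q \<longleftrightarrow>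
     continuous_on {0..1} p \<and> q \<in> borel_measurable Mtheta \<and> bounded (q ` {0..1}) \<and>
     (\<forall>a\<in>{0..1}. \<forall>\<theta>\<in>{0..1}. p \<theta> - q a * u a \<theta> \<ge> V a \<theta>)"

definition dual_solution :: "(real \<Rightarrow> real \<Rightarrow> real) \<Rightarrow> (real \<Rightarrow> real \<Rightarrow> real)
    \<Rightarrow> real measure \<Rightarrow> (real \<Rightarrow> real) \<Rightarrow> bool" where
  "dual_solution V u \<phi> p \<longleftrightarrow>
     (\<exists>q. dual_feasible V u p q) \<and>
     (\<forall>p' q'. dual_feasible V u p' q' \<longrightarrow> (\<integral>\<theta>. p \<theta> \<partial>\<phi>) \<le> (\<integral>\<theta>. p' \<theta> \<partial>\<phi>))"

definition qtilde :: "(real \<Rightarrow> real \<Rightarrow> real) \<Rightarrow> (real \<Rightarrow> real \<Rightarrow> real) \<Rightarrow> (real \<Rightarrow> real \<Rightarrow> real)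
    \<Rightarrow> (real \<Rightarrow> real \<Rightarrow> real) \<Rightarrow> real \<Rightarrow> real \<Rightarrow> real" where
  "qtilde V u v ua a \<theta> =
     (if u a \<theta> = 0 then v a \<theta> / (- ua a \<theta>)
      else (V (a_star u (return Mtheta \<theta>)) \<theta> - V a \<theta>) / u a \<theta>)"

definition Cbound :: "(real \<Rightarrow> real \<Rightarrow> real) \<Rightarrow> (real \<Rightarrow> real \<Rightarrow> real) \<Rightarrow> (real \<Rightarrow> real \<Rightarrow> real)
    \<Rightarrow> (real \<Rightarrow> real \<Rightarrow> real) \<Rightarrow> real" where
  "Cbound V u v ua = Sup ((\<lambda>(a, \<theta>). \<bar>qtilde V u v ua a \<theta>\<bar>) ` ({0..1} \<times> {0..1}))"

definition Qset :: "(real \<Rightarrow> real \<Rightarrow> real) \<Rightarrow> (real \<Rightarrow> real \<Rightarrow> real) \<Rightarrow> (real \<Rightarrow> real \<Rightarrow> real)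
    \<Rightarrow> (real \<Rightarrow> real \<Rightarrow> real) \<Rightarrow> (real \<Rightarrow> real) \<Rightarrow> real \<Rightarrow> real set" where
  "Qset V u v ua p a = {r. r \<in> {- Cbound V u v ua .. Cbound V u v ua} \<and>
                         (\<forall>\<theta>\<in>{0..1}. p \<theta> \<ge> V a \<theta> + r * u a \<theta>)}"

definition qfun :: "(real \<Rightarrow> real \<Rightarrow> real) \<Rightarrow> (real \<Rightarrow> real \<Rightarrow> real) \<Rightarrow> (real \<Rightarrow> real \<Rightarrow> real)
    \<Rightarrow> (real \<Rightarrow> real \<Rightarrow> real) \<Rightarrow> (real \<Rightarrow> real) \<Rightarrow> real \<Rightarrow> real" where
  "qfun V u v ua p a =
     (let t = theta_star u a in
      if t \<in> {0..1} \<and> p t = V a t then v a t / (- ua a t)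
      else (Inf (Qset V u v ua p a) + Sup (Qset V u v ua p a)) / 2)"

definition Gamma :: "(real \<Rightarrow> real \<Rightarrow> real) \<Rightarrow> (real \<Rightarrow> real \<Rightarrow> real) \<Rightarrow> (real \<Rightarrow> real \<Rightarrow> real)
    \<Rightarrow> (real \<Rightarrow> real \<Rightarrow> real) \<Rightarrow> (real \<Rightarrow> real) \<Rightarrow> (real \<times> real) set" where
  "Gamma V u v ua p = {(a, \<theta>). a \<in> {0..1} \<and> \<theta> \<in> {0..1} \<and>
                          p \<theta> = V a \<theta> + qfun V u v ua p a * u a \<theta>}"

definition Gamma_sec :: "(real \<Rightarrow> real \<Rightarrow> real) \<Rightarrow> (real \<Rightarrow> real \<Rightarrow> real) \<Rightarrow> (real \<Rightarrow> real \<Rightarrow> real)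
    \<Rightarrow> (real \<Rightarrow> real \<Rightarrow> real) \<Rightarrow> (real \<Rightarrow> real) \<Rightarrow> real \<Rightarrow> real set" where
  "Gamma_sec V u v ua p a = {\<theta>. (a, \<theta>) \<in> Gamma V u v ua p}"

definition Gamma_star_sec :: "(real \<Rightarrow> real \<Rightarrow> real) \<Rightarrow> (real \<Rightarrow> real \<Rightarrow> real) \<Rightarrow> (real \<Rightarrow> real \<Rightarrow> real)
    \<Rightarrow> (real \<Rightarrow> real \<Rightarrow> real) \<Rightarrow> (real \<Rightarrow> real) \<Rightarrow> real \<Rightarrow> real set" where
  "Gamma_star_sec V u v ua p a =
     (let G = Gamma_sec V u v ua p a in
      if G \<noteq> {} \<and> theta_star u a \<in> {Inf G, Sup G} then {theta_star u a} else G)"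

end

theory Submission
  imports Defs
begin

text \<open>
  Write \<open>Vfd \<theta>\<close> for the sender's value of disclosing \<open>\<theta>\<close>. If full disclosure is optimal,
  pooling small pieces of the prior near two states \<open>\<theta>1 < \<theta>*(a) < \<theta>2\<close> into the action \<open>a\<close>
  cannot help, which orders the ratios \<open>(Vfd \<theta> - V a \<theta>) / u a \<theta>\<close> on the two sides of
  \<open>\<theta>*(a)\<close>. Letting one state tend to \<open>\<theta>*(a)\<close> shows that \<open>Vfd\<close>, together with
  \<open>q a = v / (- ua)\<close> at \<open>\<theta>*(a)\<close>, is dual feasible. Every dual price is at least \<open>Vfd\<close>,
  so by full support the dual solution is \<open>Vfd\<close>, without any appeal to strong duality. Hence every
  section of the contact set contains \<open>\<theta>*(a)\<close>, and pairwiseness forces it to lie on one side of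
  \<open>\<theta>*(a)\<close>, where \<open>u a\<close> has constant sign. An optimal outcome is carried by the contact set, so
  obedience gives \<open>u a \<theta> = 0\<close> almost everywhere, which is full disclosure.
\<close>

section \<open>The receiver's response\<close>

text \<open>Every zero is crossed strictly downwards, and two consecutive downward crossings are
  impossible: the function would be negative just after the first zero and positive just before the
  second.\<close>

lemma strict_crossing:
  fixes f f' :: "real \<Rightarrow> real"
  assumes der: "\<And>x. x \<in> {0..1} \<Longrightarrow> (f has_real_derivative f' x) (at x within {0..1})"
    and neg: "\<And>x. x \<in> {0..1} \<Longrightarrow> f x = 0 \<Longrightarrow> f' x < 0"
    and f0: "0 \<le> f 0" and f1: "f 1 \<le> 0"
  obtains c where "c \<in> {0..1}" "f c = 0"
    "\<And>x. x \<in> {0..<c} \<Longrightarrow> 0 < f x" "\<And>x. x \<in> {c<..1} \<Longrightarrow> f x < 0"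
proof -
  have cont: "continuous_on {0..1} f"
    using der by (meson DERIV_continuous continuous_on_eq_continuous_within)
  have after: "f y < 0" if x: "x \<in> {0..1}" "f x = 0" and y: "x < y" "y \<le> 1" for x y
  proof (rule ccontr)
    assume "\<not> f y < 0"
    obtain d where d: "d > 0" "\<And>h. h > 0 \<Longrightarrow> x + h \<in> {0..1} \<Longrightarrow> h < d \<Longrightarrow> f (x + h) < 0"
      using has_real_derivative_neg_dec_right[OF der[OF x(1)] neg[OF x]] x by auto
    define s where "s = x + min d (y - x) / 2"
    have s: "x < s" "s < y" "f s < 0"
      using d(2)[of "min d (y - x) / 2"] d(1) x y by (auto simp: s_def min_def field_simps)
    \<comment> \<open>The least element \<open>z\<close> of \<open>S\<close> is the first return of
      \<open>f\<close> to nonnegative values after \<open>s\<close>. There \<open>f\<close>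
      vanishes, yet the negative derivative makes \<open>f\<close> positive just to the left of
      \<open>z\<close>.\<close>
    define S where "S = {s..y} \<inter> f -` {0..}"
    have cs: "continuous_on {s..y} f"
      using cont by (rule continuous_on_subset) (use s x y in auto)
    have "compact S"
      unfolding S_def
      by (metis closed_atLeast compact_Icc compact_Int_closed continuous_on_closed_vimage cs
          closed_atLeastAtMost inf.left_idem inf_commute)
    moreover have "y \<in> S" using \<open>\<not> f y < 0\<close> s by (auto simp: S_def)
    ultimately obtain z where z: "z \<in> S" "\<And>t. t \<in> S \<Longrightarrow> z \<le> t"
      by (metis compact_attains_inf empty_iff)
    have z': "s < z" "z \<le> y" "0 \<le> f z" using z(1) s by (auto simp: S_def intro: le_neq_trans)
    have below: "f t < 0" if "s \<le> t" "t < z" for t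
      using z(2)[of t] that z' by (fastforce simp: S_def not_less[symmetric])
    have "f z = 0"
    proof (rule ccontr)
      assume "f z \<noteq> 0"
      have "continuous_on {s..z} f" using cs by (rule continuous_on_subset) (use z' in auto)
      then obtain t where "s \<le> t" "t \<le> z" "f t = 0"
        using IVT'[of f s 0 z] s z' by auto
      then show False using below[of t] \<open>f z \<noteq> 0\<close> by (cases "t = z") auto
    qed
    have zI: "z \<in> {0..1}" using s x y z' by auto
    obtain e where e: "e > 0" "\<And>h. h > 0 \<Longrightarrow> z - h \<in> {0..1} \<Longrightarrow> h < e \<Longrightarrow> 0 < f (z - h)"
      using has_real_derivative_neg_dec_left[OF der[OF zI] neg[OF zI \<open>f z = 0\<close>]] \<open>f z = 0\<close> by auto
    define h where "h = min e (z - s) / 2"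
    have "h > 0" "h < e" "s \<le> z - h" "z - h < z"
      using e(1) z' by (auto simp: h_def min_def field_simps)
    then show False using e(2)[of h] below[of "z - h"] zI s x by force
  qed
  obtain c where c: "c \<in> {0..1}" "f c = 0"
    using IVT2'[of f 1 0 0] f0 f1 cont by auto
  show ?thesis
  proof (rule that[OF c])
    fix y assume y: "y \<in> {0..<c}"
    show "0 < f y"
    proof (rule ccontr)
      \<comment> \<open>A nonpositive value before \<open>c\<close> produces an earlier zero, after
        which \<open>f\<close> is negative, contradicting \<open>f c = 0\<close>.\<close>
      assume "\<not> 0 < f y"
      have "continuous_on {0..y} f" using cont by (rule continuous_on_subset) (use y c in auto)
      then obtain z where "0 \<le> z" "z \<le> y" "f z = 0"
        using IVT2'[of f y 0 0] \<open>\<not> 0 < f y\<close> f0 y by auto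
      then show False using after[of z c] c y by auto
    qed
  qed (use after c in auto)
qed

section \<open>Joint continuity on the square and evaluation at point masses\<close>

lemma continuous_on_square_section:
  fixes f :: "real \<Rightarrow> real \<Rightarrow> real"
  assumes "continuous_on ({0..1} \<times> {0..1}) (\<lambda>(a, \<theta>). f a \<theta>)"
    and "continuous_on S g" "continuous_on S h"
    and "\<And>x. x \<in> S \<Longrightarrow> g x \<in> {0..1} \<and> h x \<in> {0..1}"
  shows "continuous_on S (\<lambda>x. f (g x) (h x))"
  using continuous_on_compose2[OF assms(1) continuous_on_Pair[OF assms(2,3)]] assms(4)
  by (auto simp: image_subset_iff)

lemma return_prob_on:
  "\<theta> \<in> {0..1} \<Longrightarrow> prob_on (return Mtheta \<theta>) {0..1}"
  by (simp add: prob_on_def Mtheta_def prob_space_return space_restrict_space)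

lemma integral_return_Mtheta:
  fixes f :: "real \<Rightarrow> real"
  assumes "\<theta> \<in> {0..1}" "continuous_on {0..1} f"
  shows "(\<integral>x. f x \<partial>return Mtheta \<theta>) = f \<theta>"
  using assms
  by (subst integral_return)
     (auto simp: Mtheta_def space_restrict_space intro: borel_measurable_continuous_on_restrict)

text \<open>\<open>ua_neg\<close> is strict aggregate quasi-concavity read at point masses;
  \<open>u_0\<close> and \<open>u_1\<close> split each extremum of Assumption 3 into a bound and its
  attainment.\<close>

locale receiver =
  fixes u ua :: "real \<Rightarrow> real \<Rightarrow> real"
  assumes u_deriv: "\<And>a \<theta>. a \<in> {0..1} \<Longrightarrow> \<theta> \<in> {0..1} \<Longrightarrow>
      ((\<lambda>b. u b \<theta>) has_real_derivative ua a \<theta>) (at a within {0..1})"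
    and u_cont: "continuous_on ({0..1} \<times> {0..1}) (\<lambda>(a, \<theta>). u a \<theta>)"
    and ua_cont: "continuous_on ({0..1} \<times> {0..1}) (\<lambda>(a, \<theta>). ua a \<theta>)"
    and ua_neg: "\<And>a \<theta>. a \<in> {0..1} \<Longrightarrow> \<theta> \<in> {0..1} \<Longrightarrow> u a \<theta> = 0 \<Longrightarrow> ua a \<theta> < 0"
    and u_0: "\<And>\<theta>. \<theta> \<in> {0..1} \<Longrightarrow> 0 \<le> u 0 \<theta>" "\<exists>\<theta>\<in>{0..1}. u 0 \<theta> = 0"
    and u_1: "\<And>\<theta>. \<theta> \<in> {0..1} \<Longrightarrow> u 1 \<theta> \<le> 0" "\<exists>\<theta>\<in>{0..1}. u 1 \<theta> = 0"
    and single_crossing: "\<And>a \<theta> \<theta>'. a \<in> {0..1} \<Longrightarrow> \<theta> \<in> {0..1} \<Longrightarrow> \<theta>' \<in> {0..1} \<Longrightarrow>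
      \<theta> < \<theta>' \<Longrightarrow> u a \<theta> = 0 \<Longrightarrow> 0 < u a \<theta>'"
begin

definition act :: "real \<Rightarrow> real" where
  "act \<theta> = a_star u (return Mtheta \<theta>)"

abbreviation ts :: "real \<Rightarrow> real" where
  "ts \<equiv> theta_star u"

text \<open>At a point mass the integral in \<open>a_star\<close> is the value
  \<open>u b \<theta>\<close>, so \<open>strict_crossing\<close> in the action variable yields the
  unique root and the signs around it.\<close>

lemma act:
  assumes \<theta>: "\<theta> \<in> {0..1}"
  shows act_mem: "act \<theta> \<in> {0..1}" and u_act: "u (act \<theta>) \<theta> = 0"
    and u_pos: "a \<in> {0..<act \<theta>} \<Longrightarrow> 0 < u a \<theta>" and u_neg: "a \<in> {act \<theta><..1} \<Longrightarrow> u a \<theta> < 0"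
proof -
  obtain c where c: "c \<in> {0..1}" "u c \<theta> = 0"
    "\<And>x. x \<in> {0..<c} \<Longrightarrow> 0 < u x \<theta>" "\<And>x. x \<in> {c<..1} \<Longrightarrow> u x \<theta> < 0"
    using strict_crossing[of "\<lambda>a. u a \<theta>" "\<lambda>a. ua a \<theta>"] u_deriv ua_neg u_0 u_1 \<theta> by metis
  have int: "(\<integral>x. u b x \<partial>return Mtheta \<theta>) = u b \<theta>" if "b \<in> {0..1}" for b
    by (rule integral_return_Mtheta[OF \<theta>])
       (use that in \<open>auto intro!: continuous_on_square_section[OF u_cont] continuous_intros\<close>)
  have "act \<theta> = c"
    unfolding act_def a_star_def
  proof (rule the_equality)
    fix b assume "b \<in> {0..1} \<and> (\<integral>x. u b x \<partial>return Mtheta \<theta>) = 0"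
    then have "b \<in> {0..1}" "u b \<theta> = 0" using int by auto
    then show "b = c" using c(3)[of b] c(4)[of b] by force
  qed (use c int in auto)
  then show "act \<theta> \<in> {0..1}" "u (act \<theta>) \<theta> = 0"
    "a \<in> {0..<act \<theta>} \<Longrightarrow> 0 < u a \<theta>" "a \<in> {act \<theta><..1} \<Longrightarrow> u a \<theta> < 0"
    using c by auto
qed

lemma u_eq_0_iff:
  assumes "a \<in> {0..1}" "\<theta> \<in> {0..1}"
  shows "u a \<theta> = 0 \<longleftrightarrow> a = act \<theta>"
  using u_act[OF assms(2)] u_pos[OF assms(2), of a] u_neg[OF assms(2), of a] assms(1) by force

text \<open>At the action \<open>act \<theta>\<close> single crossing makes \<open>u\<close>
  positive for the higher state, whereas \<open>u\<close> at that state is nonpositive from its own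
  root \<open>act \<theta>'\<close> onwards.\<close>

lemma act_strict_mono:
  assumes "\<theta> \<in> {0..1}" "\<theta>' \<in> {0..1}" "\<theta> < \<theta>'"
  shows "act \<theta> < act \<theta>'"
proof (rule ccontr)
  assume *: "\<not> act \<theta> < act \<theta>'"
  have "0 < u (act \<theta>) \<theta>'"
    using single_crossing[OF act_mem[OF assms(1)] assms u_act[OF assms(1)]] .
  then show False
    using * u_act[OF assms(2)] u_neg[OF assms(2), of "act \<theta>"] act_mem[OF assms(1)] by force
qed

text \<open>The graph of \<open>act\<close> is the zero set of \<open>u\<close> in the square, hence
  closed, and a closed graph into a compact set gives continuity.\<close>

lemma act_continuous: "continuous_on {0..1} act"
proof (rule continuous_from_closed_graph[of "{0..1}"])
  have "(\<lambda>\<theta>. (\<theta>, act \<theta>)) ` {0..1} = ({0..1} \<times> {0..1}) \<inter> (\<lambda>x. u (snd x) (fst x)) -` {0}"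
    using act_mem u_act u_eq_0_iff by fastforce
  moreover have "closed \<dots>"
    by (intro continuous_closed_preimage continuous_on_square_section[OF u_cont] continuous_intros
        closed_Times) auto
  ultimately show "closed ((\<lambda>\<theta>. (\<theta>, act \<theta>)) ` {0..1})" by simp
qed (use act_mem in auto)

text \<open>Assumption 3 supplies a state whose root is the extreme action. It must be the extreme
  state, since otherwise strict monotonicity would push the action at the extreme state out of
  \<open>[0,1]\<close>.\<close>

lemma act_0: "act 0 = 0" and act_1: "act 1 = 1"
proof -
  obtain t where "t \<in> {0..1}" "u 0 t = 0" using u_0 by auto
  then show "act 0 = 0"
    using act_strict_mono[of 0 t] u_eq_0_iff[of 0 t] act_mem[of 0] by (cases "t = 0") auto
  obtain t where "t \<in> {0..1}" "u 1 t = 0" using u_1 by auto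
  then show "act 1 = 1"
    using act_strict_mono[of t 1] u_eq_0_iff[of 1 t] act_mem[of 1] by (cases "t = 1") auto
qed

text \<open>\<open>act\<close> runs continuously and strictly upwards from 0 to 1, so each action is
  the root for exactly one state.\<close>

lemma ts:
  assumes a: "a \<in> {0..1}"
  shows ts_mem: "ts a \<in> {0..1}" and act_ts: "act (ts a) = a" and u_ts: "u a (ts a) = 0"
proof -
  obtain t where t: "t \<in> {0..1}" "act t = a"
    using IVT'[of act 0 a 1] act_0 act_1 act_continuous a by auto
  have "ts a = t"
    unfolding theta_star_def
  proof (rule the_equality)
    fix s assume "s \<in> {0..1} \<and> u a s = 0"
    then show "s = t"
      using u_eq_0_iff[OF a, of s] act_strict_mono[of s t] act_strict_mono[of t s] t by force
  qed (use t u_act in auto)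
  then show "ts a \<in> {0..1}" "act (ts a) = a" "u a (ts a) = 0" using t u_act[OF t(1)] by auto
qed

lemma ts_act: "\<theta> \<in> {0..1} \<Longrightarrow> ts (act \<theta>) = \<theta>"
  using act_strict_mono[of \<theta> "ts (act \<theta>)"] act_strict_mono[of "ts (act \<theta>)" \<theta>]
    ts_mem[OF act_mem] act_ts[OF act_mem] by force

lemma ts_continuous: "continuous_on {0..1} ts"
proof (rule continuous_from_closed_graph[of "{0..1}"])
  have "(\<lambda>a. (a, ts a)) ` {0..1} = ({0..1} \<times> {0..1}) \<inter> (\<lambda>x. u (fst x) (snd x)) -` {0}"
    using ts_mem u_ts u_eq_0_iff ts_act by fastforce
  moreover have "closed \<dots>"
    by (intro continuous_closed_preimage continuous_on_square_section[OF u_cont] continuous_intros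
        closed_Times) auto
  ultimately show "closed ((\<lambda>a. (a, ts a)) ` {0..1})" by simp
qed (use ts_mem in auto)

text \<open>States above \<open>ts a\<close> have their root above \<open>a\<close>, and
  \<open>u\<close> is positive below the root; symmetrically on the other side.\<close>

lemma u_sign:
  assumes "a \<in> {0..1}" "\<theta> \<in> {0..1}"
  shows "0 < u a \<theta> \<longleftrightarrow> ts a < \<theta>" "u a \<theta> < 0 \<longleftrightarrow> \<theta> < ts a"
  using act_strict_mono[of \<theta> "ts a"] act_strict_mono[of "ts a" \<theta>] assms ts_mem act_ts u_ts
    u_pos[of \<theta> a] u_neg[of \<theta> a] by (smt (verit) atLeastLessThan_iff greaterThanAtMost_iff atLeastAtMost_iff)+

end

section \<open>Measures on states and outcomes\<close>

text \<open>A coin with bias \<open>w x\<close> chooses between \<open>X x\<close> and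
  \<open>Y x\<close>. The randomization is realized as a density on the product with a two-point
  counting measure, then pushed forward; it serves to pool a fraction of each state.\<close>

lemma exists_mixture:
  fixes w :: "'a \<Rightarrow> real"
  assumes "prob_space M" and w[measurable]: "w \<in> borel_measurable M"
    and w01: "\<And>x. x \<in> space M \<Longrightarrow> 0 \<le> w x \<and> w x \<le> 1"
    and X[measurable]: "X \<in> measurable M N" and Y[measurable]: "Y \<in> measurable M N"
  obtains P where "prob_space P" "sets P = sets N"
    "\<And>f :: 'b \<Rightarrow> real. f \<in> borel_measurable N \<Longrightarrow> bounded (f ` space N) \<Longrightarrow>
      (\<integral>y. f y \<partial>P) = (\<integral>x. w x * f (X x) + (1 - w x) * f (Y x) \<partial>M)"
proof -
  interpret M: prob_space M by fact
  interpret C: finite_measure "count_space (UNIV :: bool set)" by (rule finite_measure_count_space) simp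
  interpret P: pair_sigma_finite M "count_space (UNIV :: bool set)" ..
  interpret MC: finite_measure "M \<Otimes>\<^sub>M count_space (UNIV :: bool set)"
    by (rule finite_measure_pair_measure) unfold_locales
  define k :: "'a \<times> bool \<Rightarrow> real" where "k = (\<lambda>(x, b). if b then w x else 1 - w x)"
  define Z where "Z = (\<lambda>(x, b). if b then X x else Y x)"
  have k[measurable]: "k \<in> borel_measurable (M \<Otimes>\<^sub>M count_space UNIV)"
    unfolding k_def by measurable
  have Z[measurable]: "Z \<in> measurable (M \<Otimes>\<^sub>M count_space UNIV) N"
    unfolding Z_def by measurable
  have k01: "0 \<le> k z \<and> k z \<le> 1" if "z \<in> space (M \<Otimes>\<^sub>M count_space (UNIV :: bool set))" for z
    using w01 that by (auto simp: k_def space_pair_measure)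
  define D where "D = density (M \<Otimes>\<^sub>M count_space (UNIV :: bool set)) (\<lambda>z. ennreal (k z))"
  have Z'[measurable]: "Z \<in> measurable D N" by (simp add: D_def)
  have "emeasure D (space D) = (\<integral>\<^sup>+z. ennreal (k z) \<partial>(M \<Otimes>\<^sub>M count_space UNIV))"
    by (simp add: D_def emeasure_density cong: nn_integral_cong)
  also have "\<dots> = (\<integral>\<^sup>+x. \<integral>\<^sup>+b. ennreal (k (x, b)) \<partial>count_space UNIV \<partial>M)"
    by (rule C.nn_integral_fst[symmetric]) simp
  also have "\<dots> = (\<integral>\<^sup>+x. 1 \<partial>M)"
    using w01 by (intro nn_integral_cong)
      (auto simp: nn_integral_count_space_finite UNIV_bool k_def ennreal_plus[symmetric]
        simp del: ennreal_plus)
  finally have "prob_space D" by (intro prob_spaceI) (simp add: M.emeasure_space_1)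
  show ?thesis
  proof (rule that[of "distr D N Z"])
    show "prob_space (distr D N Z)" using \<open>prob_space D\<close> by (rule prob_space.prob_space_distr) simp
    show "sets (distr D N Z) = sets N" by simp
    fix f :: "'b \<Rightarrow> real"
    assume f[measurable]: "f \<in> borel_measurable N" and "bounded (f ` space N)"
    then obtain B where B: "\<And>y. y \<in> space N \<Longrightarrow> \<bar>f y\<bar> \<le> B"
      by (auto simp: bounded_iff)
    have int: "integrable (M \<Otimes>\<^sub>M count_space UNIV) (\<lambda>z. k z * f (Z z))"
    proof (rule MC.integrable_const_bound[where B = B])
      show "AE z in M \<Otimes>\<^sub>M count_space UNIV. norm (k z * f (Z z)) \<le> B"
      proof (rule AE_I2)
        fix z assume z: "z \<in> space (M \<Otimes>\<^sub>M count_space (UNIV :: bool set))"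
        have "\<bar>f (Z z)\<bar> \<le> B" using B measurable_space[OF Z z] by auto
        then show "norm (k z * f (Z z)) \<le> B"
          using mult_mono[of "\<bar>k z\<bar>" 1 "\<bar>f (Z z)\<bar>" B] k01[OF z] by (simp add: abs_mult)
      qed
    qed simp
    have "(\<integral>y. f y \<partial>distr D N Z) = (\<integral>z. f (Z z) \<partial>D)" by (rule integral_distr) simp_all
    also have "\<dots> = (\<integral>z. k z * f (Z z) \<partial>(M \<Otimes>\<^sub>M count_space UNIV))"
      unfolding D_def using k01 by (subst integral_density) auto
    also have "\<dots> = (\<integral>x. \<integral>b. k (x, b) * f (Z (x, b)) \<partial>count_space UNIV \<partial>M)"
      by (rule P.integral_fst'[OF int, symmetric])
    also have "\<dots> = (\<integral>x. w x * f (X x) + (1 - w x) * f (Y x) \<partial>M)"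
      by (simp add: lebesgue_integral_count_space_finite UNIV_bool k_def Z_def add.commute)
    finally show "(\<integral>y. f y \<partial>distr D N Z) = (\<integral>x. w x * f (X x) + (1 - w x) * f (Y x) \<partial>M)" .
  qed
qed

text \<open>The hypothesis \<open>zero\<close> says that the conditional expectation of
  \<open>f\<close> given \<open>X\<close> vanishes, and a function of \<open>X\<close> can be pulled
  out of it. This carries obedience from sets of actions to multipliers such as
  \<open>q\<close>.\<close>

lemma integral_mult_eq_0:
  fixes f :: "'a \<Rightarrow> real" and g :: "'b \<Rightarrow> real"
  assumes "finite_measure M" and X[measurable]: "X \<in> measurable M N" and f: "integrable M f"
    and zero: "\<And>A. A \<in> sets N \<Longrightarrow> (\<integral>x. indicator A (X x) * f x \<partial>M) = 0"
    and g[measurable]: "g \<in> borel_measurable N" and gf: "integrable M (\<lambda>x. g (X x) * f x)"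
  shows "(\<integral>x. g (X x) * f x \<partial>M) = 0"
proof -
  define F where "F = vimage_algebra (space M) X N"
  have X': "X \<in> space M \<rightarrow> space N" using X by (rule measurable_space[THEN funcsetI])
  have setsF: "sets F = {X -` A \<inter> space M |A. A \<in> sets N}"
    unfolding F_def by (rule sets_vimage_algebra2[OF X'])
  interpret finite_measure M by fact
  interpret finite_measure_subalgebra M F
  proof (unfold_locales, unfold subalgebra_def, intro conjI subsetI)
    show "space F = space M" by (simp add: F_def)
    show "A \<in> sets M" if "A \<in> sets F" for A using that measurable_sets[OF X] by (auto simp: setsF)
  qed
  have XF: "X \<in> measurable F N"
    unfolding F_def by (rule measurable_vimage_algebra1[OF X'])
  have gF: "(\<lambda>x. g (X x)) \<in> borel_measurable F" by (rule measurable_compose[OF XF g])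
  have ce: "AE x in M. real_cond_exp M F f x = 0"
  proof (rule real_cond_exp_charact)
    fix A assume "A \<in> sets F"
    then obtain B where B: "B \<in> sets N" "A = X -` B \<inter> space M" by (auto simp: setsF)
    have "(\<integral>x\<in>A. f x \<partial>M) = (\<integral>x. indicator B (X x) * f x \<partial>M)"
      unfolding set_lebesgue_integral_def B
      by (rule Bochner_Integration.integral_cong) (auto simp: indicator_def)
    then show "(\<integral>x\<in>A. f x \<partial>M) = (\<integral>x\<in>A. 0 \<partial>M)" using zero[OF B(1)] by simp
  qed (use f in auto)
  have "(\<integral>x. g (X x) * f x \<partial>M) = (\<integral>x. g (X x) * real_cond_exp M F f x \<partial>M)"
    using real_cond_exp_intg(2)[OF gf gF] f by simp
  also have "\<dots> = 0" using ce gf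
    by (intro integral_eq_zero_AE) auto
  finally show ?thesis .
qed

text \<open>If \<open>N\<close> were null, its complement would be a compact set of measure one, and
  the support, being the intersection of all such sets, would miss \<open>N\<close>.\<close>

lemma open_nonnull:
  assumes prior: "prob_on \<phi> {0..1::real}" and supp: "supp \<phi> = {0..1}"
    and N: "openin (top_of_set {0..1}) N" "N \<noteq> {}"
  shows "N \<in> sets \<phi>" "emeasure \<phi> N \<noteq> 0"
proof -
  have sets: "sets \<phi> = sets (restrict_space borel {0..1})" and "prob_space \<phi>"
    using prior by (auto simp: prob_on_def)
  interpret prob_space \<phi> by fact
  have space: "space \<phi> = {0..1}" using sets_eq_imp_space_eq[OF sets] by (simp add: space_restrict_space)
  obtain T where T: "open T" "N = {0..1} \<inter> T" using N by (auto simp: openin_open)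
  show N': "N \<in> sets \<phi>" using T by (auto simp: sets sets_restrict_space)
  show "emeasure \<phi> N \<noteq> 0"
  proof
    assume "emeasure \<phi> N = 0"
    define K where "K = {0..1} - T"
    have K: "K = space \<phi> - N" using T space by (auto simp: K_def)
    have "compact K" unfolding K_def using T(1) by (intro compact_diff) auto
    moreover have "emeasure \<phi> K = 1"
      using \<open>emeasure \<phi> N = 0\<close> N' sets.sets_into_space[OF N']
      unfolding K by (subst emeasure_Diff) (auto simp: emeasure_space_1)
    moreover have "K \<in> sets \<phi>" unfolding K using N' by auto
    ultimately have "supp \<phi> \<subseteq> K" unfolding supp_def using K by (intro Inf_lower) auto
    then show False using supp N T by (auto simp: K_def)
  qed
qed

text \<open>A zero integral would force \<open>f\<close> to vanish almost everywhere and so make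
  \<open>N\<close> null.\<close>

lemma integral_pos_on_open:
  fixes f :: "real \<Rightarrow> real"
  assumes prior: "prob_on \<phi> {0..1}" and supp: "supp \<phi> = {0..1}"
    and N: "openin (top_of_set {0..1}) N" "N \<noteq> {}"
    and f: "integrable \<phi> f" and nn: "\<And>x. x \<in> {0..1} \<Longrightarrow> 0 \<le> f x" and pos: "\<And>x. x \<in> N \<Longrightarrow> 0 < f x"
  shows "0 < (\<integral>x. f x \<partial>\<phi>)"
proof -
  have sets: "sets \<phi> = sets (restrict_space borel {0..1})" using prior by (auto simp: prob_on_def)
  have space: "space \<phi> = {0..1}" using sets_eq_imp_space_eq[OF sets] by (simp add: space_restrict_space)
  have nn': "AE x in \<phi>. 0 \<le> f x" using nn space by auto
  have "(\<integral>x. f x \<partial>\<phi>) \<noteq> 0"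
  proof
    assume "(\<integral>x. f x \<partial>\<phi>) = 0"
    then have "AE x in \<phi>. f x = 0" using integral_nonneg_eq_0_iff_AE[OF f nn'] by simp
    then have "AE x in \<phi>. x \<notin> N" by eventually_elim (use pos in force)
    then have "emeasure \<phi> N = 0"
      using AE_iff_measurable[of N \<phi> "\<lambda>x. x \<notin> N"] open_nonnull(1)[OF prior supp N]
        sets.sets_into_space[of N \<phi>] by auto
    then show False using open_nonnull(2)[OF prior supp N] by simp
  qed
  then show ?thesis using integral_nonneg_AE[OF nn'] by linarith
qed

section \<open>Measurability and integrability for states and outcomes\<close>

lemma space_Mtheta: "space Mtheta = {0..1}" and space_Mout: "space Mout = {0..1} \<times> {0..1}"
  by (auto simp: Mtheta_def Mout_def space_restrict_space)

lemma prob_on_Mtheta: "prob_on M {0..1} \<longleftrightarrow> prob_space M \<and> sets M = sets Mtheta"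
  and prob_on_Mout: "prob_on P ({0..1} \<times> {0..1}) \<longleftrightarrow> prob_space P \<and> sets P = sets Mout"
  by (simp_all add: prob_on_def Mtheta_def Mout_def)

lemma measurable_into_Mout:
  assumes "f \<in> borel_measurable M" "g \<in> borel_measurable M"
    and "\<And>x. x \<in> space M \<Longrightarrow> f x \<in> {0..1} \<and> g x \<in> {0..1}"
  shows "(\<lambda>x. (f x, g x)) \<in> measurable M Mout"
  unfolding Mout_def using assms by (intro measurable_restrict_space2) auto

lemma measurable_Mout_fst: "fst \<in> measurable Mout Mtheta"
  and measurable_Mout_snd: "snd \<in> measurable Mout Mtheta"
proof -
  have "fst \<in> borel_measurable (borel :: (real \<times> real) measure)"
    "snd \<in> borel_measurable (borel :: (real \<times> real) measure)"
    by (simp_all add: borel_prod[symmetric])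
  then show "fst \<in> measurable Mout Mtheta" "snd \<in> measurable Mout Mtheta"
    unfolding Mout_def Mtheta_def
    by (intro measurable_restrict_space2 measurable_restrict_space1; force simp: space_restrict_space)+
qed

lemma continuous_measurable_Mtheta:
  "continuous_on {0..1} f \<Longrightarrow> f \<in> borel_measurable Mtheta"
  unfolding Mtheta_def by (rule borel_measurable_continuous_on_restrict)

lemma continuous_measurable_Mout:
  "continuous_on ({0..1} \<times> {0..1}) f \<Longrightarrow> f \<in> borel_measurable Mout"
  unfolding Mout_def by (rule borel_measurable_continuous_on_restrict)

lemma integrable_bounded:
  fixes f :: "'a \<Rightarrow> real"
  assumes "prob_space M" "sets M = sets N" "f \<in> borel_measurable N" "bounded (f ` space N)"
  shows "integrable M f"
proof -
  interpret prob_space M by fact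
  obtain B where "\<And>x. x \<in> space N \<Longrightarrow> \<bar>f x\<bar> \<le> B" using assms(4) by (auto simp: bounded_iff)
  then show ?thesis
    using assms sets_eq_imp_space_eq[OF assms(2)]
    by (intro integrable_const_bound[where B = B]) (auto cong: measurable_cong_sets)
qed

lemma continuous_bounded_Mout:
  fixes f :: "real \<times> real \<Rightarrow> real"
  shows "continuous_on ({0..1} \<times> {0..1}) f \<Longrightarrow> bounded (f ` space Mout)"
  unfolding space_Mout by (intro compact_imp_bounded compact_continuous_image compact_Times compact_Icc)

lemma integrable_Mtheta:
  fixes f :: "real \<Rightarrow> real"
  assumes "prob_on M {0..1}" "continuous_on {0..1} f"
  shows "integrable M f"
  using assms
  by (intro integrable_bounded[of M Mtheta])
     (auto simp: prob_on_Mtheta space_Mtheta continuous_measurable_Mtheta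
       intro: compact_imp_bounded compact_continuous_image)

lemma integrable_Mout:
  fixes f :: "real \<times> real \<Rightarrow> real"
  assumes "prob_on P ({0..1} \<times> {0..1})" "continuous_on ({0..1} \<times> {0..1}) f"
  shows "integrable P f"
  using assms
  by (intro integrable_bounded[of P Mout])
     (auto simp: prob_on_Mout continuous_measurable_Mout continuous_bounded_Mout)

text \<open>The indicator form matches the test integrals in \<open>integral_mult_eq_0\<close>; on
  the square, membership in \<open>A \<times> {0..1}\<close> restricts the action alone.\<close>

lemma implementable_iff:
  "implementable u \<phi> P \<longleftrightarrow> prob_on P ({0..1} \<times> {0..1}) \<and> distr P Mtheta snd = \<phi> \<and>
    (\<forall>A \<in> sets Mtheta. (\<integral>x. indicator A (fst x) * u (fst x) (snd x) \<partial>P) = 0)"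
proof -
  have "(\<integral>x\<in>A \<times> {0..1}. u (fst x) (snd x) \<partial>P) = (\<integral>x. indicator A (fst x) * u (fst x) (snd x) \<partial>P)"
    if "prob_on P ({0..1} \<times> {0..1})" for A
  proof -
    have "space P = {0..1} \<times> {0..1}"
      using that sets_eq_imp_space_eq[of P Mout] by (auto simp: prob_on_Mout space_Mout)
    then show ?thesis
      unfolding set_lebesgue_integral_def
      by (intro Bochner_Integration.integral_cong) (auto simp: indicator_def)
  qed
  then show ?thesis unfolding implementable_def by auto
qed

section \<open>The price supporting full disclosure\<close>

locale persuasion = receiver +
  fixes V v :: "real \<Rightarrow> real \<Rightarrow> real" and \<phi> :: "real measure"
  assumes V_deriv: "\<And>a \<theta>. a \<in> {0..1} \<Longrightarrow> \<theta> \<in> {0..1} \<Longrightarrow>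
      ((\<lambda>b. V b \<theta>) has_real_derivative v a \<theta>) (at a within {0..1})"
    and V_cont: "continuous_on ({0..1} \<times> {0..1}) (\<lambda>(a, \<theta>). V a \<theta>)"
    and v_cont: "continuous_on ({0..1} \<times> {0..1}) (\<lambda>(a, \<theta>). v a \<theta>)"
    and prior: "prob_on \<phi> {0..1}"
    and full_support: "supp \<phi> = {0..1}"
begin

definition Vfd :: "real \<Rightarrow> real" where
  "Vfd \<theta> = V (act \<theta>) \<theta>"

text \<open>This is \<open>qtilde\<close> at \<open>(a, ts a)\<close>, the branch that
  \<open>qfun\<close> takes when \<open>ts a\<close> lies in the contact section.\<close>

definition q :: "real \<Rightarrow> real" where
  "q a = v a (ts a) / (- ua a (ts a))"

lemma sets_prior: "sets \<phi> = sets Mtheta" and prob_space_prior: "prob_space \<phi>"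
  using prior by (auto simp: prob_on_Mtheta)

lemma space_prior: "space \<phi> = {0..1}"
  using sets_eq_imp_space_eq[OF sets_prior] by (simp add: space_Mtheta)

lemmas u_cont' = continuous_on_square_section[OF u_cont]
lemmas ua_cont' = continuous_on_square_section[OF ua_cont]
lemmas V_cont' = continuous_on_square_section[OF V_cont]
lemmas v_cont' = continuous_on_square_section[OF v_cont]

lemma Vfd_continuous: "continuous_on {0..1} Vfd"
  unfolding Vfd_def using act_mem by (intro V_cont' act_continuous continuous_intros) auto

lemma q_continuous: "continuous_on {0..1} q"
  unfolding q_def
proof (intro continuous_intros v_cont' ua_cont' ts_continuous)
  show "\<forall>a\<in>{0..1}. - ua a (ts a) \<noteq> 0" using ua_neg[OF _ ts_mem u_ts] by force
qed (use ts_mem in auto)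

lemma ts_bounds: "a \<in> {0<..<1} \<Longrightarrow> ts a \<in> {0<..<1}"
  using ts_mem[of a] act_ts[of a] act_0 act_1 by (cases "ts a = 0"; cases "ts a = 1") auto

text \<open>Cauchy's mean value theorem turns the ratio into \<open>- v b \<theta> / ua b \<theta>\<close>
  for some \<open>b\<close> between \<open>a\<close> and \<open>act \<theta>\<close>.\<close>

lemma ratio_tendsto:
  assumes a: "a \<in> {0..1}"
  shows "((\<lambda>\<theta>. (Vfd \<theta> - V a \<theta>) / u a \<theta>) \<longlongrightarrow> q a) (at (ts a) within {0..1})"
proof -
  let ?F = "at (ts a) within {0..1}"
  have "\<exists>b\<in>{0..1}. \<bar>b - a\<bar> \<le> \<bar>act \<theta> - a\<bar> \<and> (Vfd \<theta> - V a \<theta>) * ua b \<theta> = - u a \<theta> * v b \<theta>"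
    if \<theta>: "\<theta> \<in> {0..1}" for \<theta>
  proof -
    \<comment> \<open>\<open>D\<close> takes the same value at \<open>a\<close> and at
      \<open>act \<theta>\<close>, so a zero of \<open>D'\<close> in between gives the identity in
      product form, without dividing by \<open>u a \<theta>\<close>.\<close>
    define D where "D x = (Vfd \<theta> - V a \<theta>) * u x \<theta> + u a \<theta> * V x \<theta>" for x
    define D' where "D' x = (Vfd \<theta> - V a \<theta>) * ua x \<theta> + u a \<theta> * v x \<theta>" for x
    have der: "(D has_real_derivative D' x) (at x within S)" if "x \<in> {0..1}" "S \<subseteq> {0..1}" for x S
      unfolding D_def[abs_def] D'_def using u_deriv[OF that(1) \<theta>] V_deriv[OF that(1) \<theta>] that(2)
      by (auto intro!: derivative_eq_intros elim: DERIV_subset)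
    have ends: "D (act \<theta>) = D a"
      by (simp add: D_def u_act[OF \<theta>] Vfd_def algebra_simps)
    have *: "\<exists>b\<in>{x<..<y}. D' b = 0" if "x < y" "x \<in> {0..1}" "y \<in> {0..1}" "D x = D y" for x y
    proof -
      have "(D has_derivative (*) (D' z)) (at z within {x..y})" if "x \<le> z" "z \<le> y" for z
        using der[of z "{x..y}"] that \<open>x \<in> {0..1}\<close> \<open>y \<in> {0..1}\<close>
        by (auto simp: has_field_derivative_def)
      then have "\<exists>b\<in>{x<..<y}. D y - D x = D' b * (y - x)"
        by (intro mvt_simple) (use that in auto)
      then show ?thesis using that by auto
    qed
    consider "a < act \<theta>" | "act \<theta> < a" | "a = act \<theta>" by linarith
    then show ?thesis
    proof cases
      case 1
      then obtain b where "b \<in> {a<..<act \<theta>}" "D' b = 0" using *[OF 1] a act_mem[OF \<theta>] ends by auto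
      then show ?thesis using a act_mem[OF \<theta>] by (intro bexI[of _ b]) (auto simp: D'_def)
    next
      case 2
      then obtain b where "b \<in> {act \<theta><..<a}" "D' b = 0" using *[OF 2] a act_mem[OF \<theta>] ends by auto
      then show ?thesis using a act_mem[OF \<theta>] by (intro bexI[of _ b]) (auto simp: D'_def)
    next
      case 3
      then show ?thesis using a u_act[OF \<theta>] by (intro bexI[of _ a]) (auto simp: Vfd_def)
    qed
  qed
  then obtain b where b: "\<And>\<theta>. \<theta> \<in> {0..1} \<Longrightarrow> b \<theta> \<in> {0..1}"
    "\<And>\<theta>. \<theta> \<in> {0..1} \<Longrightarrow> \<bar>b \<theta> - a\<bar> \<le> \<bar>act \<theta> - a\<bar>"
    "\<And>\<theta>. \<theta> \<in> {0..1} \<Longrightarrow> (Vfd \<theta> - V a \<theta>) * ua (b \<theta>) \<theta> = - u a \<theta> * v (b \<theta>) \<theta>"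
    by metis
  have ev: "\<forall>\<^sub>F \<theta> in ?F. \<theta> \<in> {0..1} \<and> \<theta> \<noteq> ts a" by (simp add: eventually_at_filter)
  \<comment> \<open>Continuity of \<open>act\<close> at \<open>ts a\<close> squeezes the
    intermediate actions \<open>b \<theta>\<close> to \<open>a\<close>.\<close>
  have "(act \<longlongrightarrow> a) ?F"
    using act_continuous ts_mem[OF a] act_ts[OF a] by (metis continuous_on_def)
  then have "(b \<longlongrightarrow> a) ?F"
    by (rule metric_tendsto_imp_tendsto) (use ev b(2) in \<open>auto elim!: eventually_mono simp: dist_real_def\<close>)
  then have pair: "((\<lambda>\<theta>. (b \<theta>, \<theta>)) \<longlongrightarrow> (a, ts a)) ?F"
    by (intro tendsto_Pair tendsto_ident_at)
  have sq: "\<forall>\<^sub>F \<theta> in ?F. (b \<theta>, \<theta>) \<in> {0..1} \<times> {0..1}"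
    using ev by eventually_elim (use b(1) in auto)
  have lim_ua: "((\<lambda>\<theta>. ua (b \<theta>) \<theta>) \<longlongrightarrow> ua a (ts a)) ?F"
    using continuous_on_tendsto_compose[OF ua_cont pair _ sq] a ts_mem[OF a] by simp
  have lim_v: "((\<lambda>\<theta>. v (b \<theta>) \<theta>) \<longlongrightarrow> v a (ts a)) ?F"
    using continuous_on_tendsto_compose[OF v_cont pair _ sq] a ts_mem[OF a] by simp
  have neg: "ua a (ts a) < 0" using ua_neg[OF a ts_mem u_ts] a by simp
  have lim: "((\<lambda>\<theta>. v (b \<theta>) \<theta> / (- ua (b \<theta>) \<theta>)) \<longlongrightarrow> q a) ?F"
    unfolding q_def using neg by (intro tendsto_intros lim_ua lim_v) auto
  have "\<forall>\<^sub>F \<theta> in ?F. ua (b \<theta>) \<theta> < 0" using lim_ua neg by (rule order_tendstoD)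
  with ev have "\<forall>\<^sub>F \<theta> in ?F. v (b \<theta>) \<theta> / (- ua (b \<theta>) \<theta>) = (Vfd \<theta> - V a \<theta>) / u a \<theta>"
  proof eventually_elim
    case (elim \<theta>)
    then have "u a \<theta> \<noteq> 0" using u_eq_0_iff[OF a, of \<theta>] ts_act[of \<theta>] by auto
    then show ?case using b(3)[of \<theta>] elim by (simp add: field_simps)
  qed
  with lim show ?thesis by (rule Lim_transform_eventually)
qed

section \<open>Pooling deviations from full disclosure\<close>

lemma measurable_action_state:
  assumes g: "continuous_on {0..1} g" and "\<And>\<theta>. \<theta> \<in> {0..1} \<Longrightarrow> g \<theta> \<in> {0..1}"
  shows "(\<lambda>\<theta>. (g \<theta>, \<theta>)) \<in> measurable \<phi> Mout"
proof (rule measurable_into_Mout)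
  show "g \<in> borel_measurable \<phi>"
    using continuous_measurable_Mtheta[OF g] by (simp add: measurable_cong_sets[OF sets_prior refl])
  show "(\<lambda>\<theta>. \<theta>) \<in> borel_measurable \<phi>"
    using continuous_measurable_Mtheta[OF continuous_on_id]
    by (simp add: measurable_cong_sets[OF sets_prior refl])
qed (use assms space_prior in auto)

lemma measurable_act: "(\<lambda>\<theta>. (act \<theta>, \<theta>)) \<in> measurable Mtheta Mout"
  using measurable_action_state[OF act_continuous act_mem]
  by (simp add: measurable_cong_sets[OF sets_prior refl])

lemma integral_full_disclosure:
  "(\<integral>x. V (fst x) (snd x) \<partial>full_disclosure u \<phi>) = (\<integral>\<theta>. Vfd \<theta> \<partial>\<phi>)"
proof -
  have "(\<lambda>x. V (fst x) (snd x)) \<in> borel_measurable Mout"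
    by (intro continuous_measurable_Mout V_cont' continuous_intros) auto
  then show ?thesis
    using measurable_act unfolding full_disclosure_def act_def[symmetric]
    by (simp add: integral_distr measurable_cong_sets[OF sets_prior refl] Vfd_def)
qed

text \<open>The weights \<open>w\<close> below make \<open>a\<close> optimal for the pooled states, so that adding a multiple
  of \<open>u a\<close> to the gain \<open>V a - Vfd\<close> does not change its \<open>w\<close>-integral.\<close>

lemma pooling_no_gain:
  assumes opt: "optimal V u \<phi> (full_disclosure u \<phi>)" and a: "a \<in> {0..1}"
    and \<theta>1: "\<theta>1 \<in> {0..1}" "u a \<theta>1 < 0" "0 < V a \<theta>1 - Vfd \<theta>1 + r * u a \<theta>1"
    and \<theta>2: "\<theta>2 \<in> {0..1}" "0 < u a \<theta>2" "0 < V a \<theta>2 - Vfd \<theta>2 + r * u a \<theta>2"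
  shows False
proof -
  have cu: "continuous_on {0..1} (u a)" and cV: "continuous_on {0..1} (V a)"
    using a by (auto intro!: u_cont' V_cont' continuous_intros)
  \<comment> \<open>The gain from moving \<open>\<theta>\<close> from \<open>act \<theta>\<close> to
    \<open>a\<close>, tilted by \<open>r * u a \<theta>\<close>. By continuity it stays positive on
    open sets around \<open>\<theta>1\<close> and \<open>\<theta>2\<close>.\<close>
  define h where "h \<theta> = V a \<theta> - Vfd \<theta> + r * u a \<theta>" for \<theta>
  have ch: "continuous_on {0..1} h"
    unfolding h_def by (intro continuous_intros cu cV Vfd_continuous)
  define N1 where "N1 = {0..1} \<inter> (\<lambda>\<theta>. min (h \<theta>) (- u a \<theta>)) -` {0<..}"
  define N2 where "N2 = {0..1} \<inter> (\<lambda>\<theta>. min (h \<theta>) (u a \<theta>)) -` {0<..}"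
  have N1: "openin (top_of_set {0..1}) N1" "N1 \<noteq> {}"
    and N2: "openin (top_of_set {0..1}) N2" "N2 \<noteq> {}"
    using \<theta>1 \<theta>2 unfolding N1_def N2_def
    by (auto simp: h_def intro!: continuous_openin_preimage_gen continuous_intros cV Vfd_continuous cu)
  note N1' = open_nonnull(1)[OF prior full_support N1]
    and N2' = open_nonnull(1)[OF prior full_support N2]
  note intg = integrable_Mtheta[OF prior]
  define f1 where "f1 \<theta> = indicator N1 \<theta> * (- u a \<theta>)" for \<theta>
  define f2 where "f2 \<theta> = indicator N2 \<theta> * u a \<theta>" for \<theta>
  have f1: "integrable \<phi> f1" and f2: "integrable \<phi> f2"
    unfolding f1_def f2_def
    using integrable_mult_indicator[OF N1' intg[OF continuous_on_minus[OF cu]]]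
      integrable_mult_indicator[OF N2' intg[OF cu]] by simp_all
  define I1 where "I1 = (\<integral>\<theta>. f1 \<theta> \<partial>\<phi>)"
  define I2 where "I2 = (\<integral>\<theta>. f2 \<theta> \<partial>\<phi>)"
  have I1: "0 < I1" unfolding I1_def
    by (rule integral_pos_on_open[OF prior full_support N1 f1])
       (auto simp: f1_def N1_def indicator_def)
  have I2: "0 < I2" unfolding I2_def
    by (rule integral_pos_on_open[OF prior full_support N2 f2])
       (auto simp: f2_def N2_def indicator_def)
  \<comment> \<open>Cross-weighting by \<open>I2\<close> and \<open>I1\<close> cancels the negative
    obedience integral over \<open>N1\<close> against the positive one over \<open>N2\<close>; the
    denominator keeps \<open>w\<close> at most 1.\<close>
  define w where "w \<theta> = (I2 * indicator N1 \<theta> + I1 * indicator N2 \<theta>) / (I1 + I2)" for \<theta>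
  have disj: "N1 \<inter> N2 = {}" by (auto simp: N1_def N2_def)
  have w01: "0 \<le> w \<theta>" "w \<theta> \<le> 1" for \<theta>
    using I1 I2 disj by (auto simp: w_def indicator_def field_simps)
  have wm: "w \<in> borel_measurable \<phi>" unfolding w_def using N1' N2' by measurable
  have wint: "integrable \<phi> (\<lambda>\<theta>. w \<theta> * g \<theta>)" if "integrable \<phi> g" for g
    by (rule Bochner_Integration.integrable_bound[OF that])
       (use wm that w01 in \<open>auto simp: abs_mult intro!: mult_left_le_one_le\<close>)
  have wu: "(\<integral>\<theta>. w \<theta> * u a \<theta> \<partial>\<phi>) = 0"
  proof -
    have "(\<integral>\<theta>. w \<theta> * u a \<theta> \<partial>\<phi>) = (\<integral>\<theta>. (I1 * f2 \<theta> - I2 * f1 \<theta>) / (I1 + I2) \<partial>\<phi>)"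
      by (rule Bochner_Integration.integral_cong) (auto simp: w_def f1_def f2_def algebra_simps)
    also have "\<dots> = (I1 * I2 - I2 * I1) / (I1 + I2)"
      using f1 f2 by (simp add: I1_def I2_def)
    finally show ?thesis by simp
  qed
  have wh: "0 < (\<integral>\<theta>. w \<theta> * h \<theta> \<partial>\<phi>)"
  proof (rule integral_pos_on_open[OF prior full_support N1 wint[OF intg[OF ch]]])
    fix \<theta> :: real
    show "0 \<le> w \<theta> * h \<theta>"
    proof (cases "\<theta> \<in> N1 \<union> N2")
      case True
      then have "0 \<le> h \<theta>" by (auto simp: N1_def N2_def)
      then show ?thesis using w01(1) by simp
    next
      case False
      then show ?thesis by (simp add: w_def)
    qed
  next
    fix \<theta> assume "\<theta> \<in> N1"
    moreover have "0 < h \<theta>" using \<open>\<theta> \<in> N1\<close> by (simp add: N1_def)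
    moreover have "\<theta> \<notin> N2" using \<open>\<theta> \<in> N1\<close> disj by auto
    ultimately have "0 < w \<theta>" "0 < h \<theta>" using I1 I2 by (simp_all add: w_def)
    then show "0 < w \<theta> * h \<theta>" by simp
  qed
  have X: "(\<lambda>\<theta>. (a, \<theta>)) \<in> measurable \<phi> Mout"
    by (rule measurable_action_state[OF continuous_on_const a])
  have Y: "(\<lambda>\<theta>. (act \<theta>, \<theta>)) \<in> measurable \<phi> Mout"
    by (rule measurable_action_state[OF act_continuous act_mem])
  \<comment> \<open>\<open>P\<close> recommends \<open>a\<close> for a fraction
    \<open>w \<theta>\<close> of each state and discloses the rest.\<close>
  obtain P where P: "prob_space P" "sets P = sets Mout"
    and intP: "\<And>f :: real \<times> real \<Rightarrow> real. f \<in> borel_measurable Mout \<Longrightarrow> bounded (f ` space Mout) \<Longrightarrow>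
      (\<integral>y. f y \<partial>P) = (\<integral>\<theta>. w \<theta> * f (a, \<theta>) + (1 - w \<theta>) * f (act \<theta>, \<theta>) \<partial>\<phi>)"
    by (rule exists_mixture[OF prob_space_prior wm conjI[OF w01] X Y]) (rule that)
  interpret P: prob_space P by fact
  interpret phi: prob_space \<phi> by (rule prob_space_prior)
  have mu: "(\<lambda>x. u (fst x) (snd x)) \<in> borel_measurable Mout" "bounded ((\<lambda>x. u (fst x) (snd x)) ` space Mout)"
    by (intro continuous_measurable_Mout continuous_bounded_Mout u_cont' continuous_intros; auto)+
  have mV: "(\<lambda>x. V (fst x) (snd x)) \<in> borel_measurable Mout" "bounded ((\<lambda>x. V (fst x) (snd x)) ` space Mout)"
    by (intro continuous_measurable_Mout continuous_bounded_Mout V_cont' continuous_intros; auto)+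
  have snd_P: "snd \<in> measurable P Mtheta"
    using measurable_Mout_snd by (simp add: measurable_cong_sets[OF P(2) refl])
  have "implementable u \<phi> P"
    unfolding implementable_iff
  proof (intro conjI ballI)
    show "prob_on P ({0..1} \<times> {0..1})" using P by (simp add: prob_on_Mout)
    show "distr P Mtheta snd = \<phi>"
    proof (rule measure_eqI)
      fix B assume "B \<in> sets (distr P Mtheta snd)"
      then have B: "B \<in> sets Mtheta" "B \<in> sets \<phi>" by (simp_all add: sets_prior)
      have "measure P (snd -` B \<inter> space P) = (\<integral>x. indicator B (snd x) \<partial>P)"
      proof -
        have "(\<integral>x. indicator B (snd x) \<partial>P) = (\<integral>x. indicator (snd -` B \<inter> space P) x \<partial>P :: real)"
          by (rule Bochner_Integration.integral_cong) (auto simp: indicator_def)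
        then show ?thesis using measurable_sets[OF snd_P B(1)] by simp
      qed
      also have "\<dots> = (\<integral>\<theta>. w \<theta> * indicator B \<theta> + (1 - w \<theta>) * indicator B \<theta> \<partial>\<phi>)"
      proof (subst intP)
        show "(\<lambda>x. indicator B (snd x) :: real) \<in> borel_measurable Mout"
          using measurable_Mout_snd B(1) by measurable
      qed (auto simp: bounded_iff indicator_def intro!: exI[of _ 1])
      also have "\<dots> = (\<integral>\<theta>. indicator B \<theta> \<partial>\<phi>)" by (simp only: distrib_right[symmetric]) simp
      also have "\<dots> = measure \<phi> B" using B by simp
      finally show "emeasure (distr P Mtheta snd) B = emeasure \<phi> B"
        using B snd_P by (simp add: emeasure_distr P.emeasure_eq_measure phi.emeasure_eq_measure)
    qed (simp add: sets_prior)
  next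
    fix A assume A: "A \<in> sets Mtheta"
    have "(\<lambda>x. indicator A (fst x) * u (fst x) (snd x)) \<in> borel_measurable Mout"
      using measurable_Mout_fst A mu(1) by measurable
    moreover have "bounded ((\<lambda>x. indicator A (fst x) * u (fst x) (snd x)) ` space Mout)"
      using mu(2) by (force simp: bounded_iff indicator_def)
    ultimately have "(\<integral>x. indicator A (fst x) * u (fst x) (snd x) \<partial>P) =
        (\<integral>\<theta>. w \<theta> * (indicator A a * u a \<theta>) + (1 - w \<theta>) * (indicator A (act \<theta>) * u (act \<theta>) \<theta>) \<partial>\<phi>)"
      by (subst intP) auto
    \<comment> \<open>Disclosed states contribute nothing since
      \<open>u (act \<theta>) \<theta> = 0\<close>; what remains is a constant times the cancelled
      integral \<open>wu\<close>.\<close>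
    also have "\<dots> = (\<integral>\<theta>. indicator A a * (w \<theta> * u a \<theta>) \<partial>\<phi>)"
      by (rule Bochner_Integration.integral_cong) (use u_act space_prior in auto)
    also have "\<dots> = 0" using wu by simp
    finally show "(\<integral>x. indicator A (fst x) * u (fst x) (snd x) \<partial>P) = 0" .
  qed
  then have "(\<integral>x. V (fst x) (snd x) \<partial>P) \<le> (\<integral>\<theta>. Vfd \<theta> \<partial>\<phi>)"
    using opt unfolding optimal_def integral_full_disclosure by blast
  \<comment> \<open>The value of \<open>P\<close> exceeds that of full disclosure by the positive
    integral \<open>wh\<close>, because the tilt integrates to zero.\<close>
  moreover have "(\<integral>x. V (fst x) (snd x) \<partial>P) = (\<integral>\<theta>. Vfd \<theta> + w \<theta> * h \<theta> - r * (w \<theta> * u a \<theta>) \<partial>\<phi>)"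
    using mV by (subst intP) (auto simp: h_def Vfd_def algebra_simps)
  moreover have "\<dots> = (\<integral>\<theta>. Vfd \<theta> \<partial>\<phi>) + (\<integral>\<theta>. w \<theta> * h \<theta> \<partial>\<phi>) - r * (\<integral>\<theta>. w \<theta> * u a \<theta> \<partial>\<phi>)"
    using intg[OF Vfd_continuous] wint[OF intg[OF ch]] wint[OF intg[OF cu]] by simp
  ultimately show False using wu wh by simp
qed

lemma at_within_side_nontrivial:
  fixes t :: real
  shows "0 < t \<Longrightarrow> at t within {0..<t} \<noteq> bot" "t < 1 \<Longrightarrow> at t within {t<..1} \<noteq> bot"
  by (simp_all add: at_within_eq_bot_iff)

text \<open>For interior \<open>a\<close> there are states on both sides of \<open>ts a\<close>, and
  \<open>pooling_no_gain\<close> orders their ratios. The limit on one side bounds the ratio on the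
  other by \<open>q a\<close>, and multiplying by \<open>u a \<theta>\<close> with its sign gives
  the inequality.\<close>

lemma full_disclosure_price_feasible:
  assumes opt: "optimal V u \<phi> (full_disclosure u \<phi>)" and a: "a \<in> {0..1}" and \<theta>: "\<theta> \<in> {0..1}"
  shows "V a \<theta> + q a * u a \<theta> \<le> Vfd \<theta>"
proof -
  have interior: "0 \<le> Vfd \<theta> - V a \<theta> - q a * u a \<theta>" if a: "a \<in> {0<..<1}" for a
  proof -
    have aI: "a \<in> {0..1}" using a by auto
    note t = ts_bounds[OF a]
    have order: "(Vfd x - V a x) / u a x \<le> (Vfd y - V a y) / u a y"
      if "x \<in> {0..<ts a}" "y \<in> {ts a<..1}" for x y
    proof (rule ccontr)
      assume "\<not> ?thesis"
      then have "(Vfd y - V a y) / u a y < (Vfd x - V a x) / u a x" by simp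
      \<comment> \<open>A multiplier strictly between the two ratios makes the tilted gain positive
        at both \<open>x\<close> and \<open>y\<close>.\<close>
      then obtain r where r: "(Vfd y - V a y) / u a y < r" "r < (Vfd x - V a x) / u a x"
        using dense by blast
      have xy: "x \<in> {0..1}" "y \<in> {0..1}" using that t by auto
      have s: "u a x < 0" "0 < u a y" using u_sign[OF aI] xy that by auto
      show False
        by (rule pooling_no_gain[OF opt aI xy(1) s(1) _ xy(2) s(2), of r])
           (use r s in \<open>auto simp: field_simps\<close>)
    qed
    note lim = ratio_tendsto[OF aI]
    consider "\<theta> = ts a" | "\<theta> \<in> {0..<ts a}" | "\<theta> \<in> {ts a<..1}"
      using \<theta> by (cases \<theta> "ts a" rule: linorder_cases) auto
    then show ?thesis
    proof cases
      case 1
      then show ?thesis using u_ts[OF aI] act_ts[OF aI] by (simp add: Vfd_def)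
    next
      case 2
      have "(Vfd \<theta> - V a \<theta>) / u a \<theta> \<le> q a"
      proof (rule tendsto_lowerbound)
        show "((\<lambda>x. (Vfd x - V a x) / u a x) \<longlongrightarrow> q a) (at (ts a) within {ts a<..1})"
          by (rule tendsto_within_subset[OF lim]) (use t in auto)
        show "\<forall>\<^sub>F x in at (ts a) within {ts a<..1}. (Vfd \<theta> - V a \<theta>) / u a \<theta> \<le> (Vfd x - V a x) / u a x"
          using order 2 by (simp add: eventually_at_filter)
      qed (use at_within_side_nontrivial t in auto)
      moreover have "u a \<theta> < 0" using u_sign[OF aI \<theta>] 2 by auto
      ultimately show ?thesis by (simp add: field_simps)
    next
      case 3
      have "q a \<le> (Vfd \<theta> - V a \<theta>) / u a \<theta>"
      proof (rule tendsto_upperbound)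
        show "((\<lambda>x. (Vfd x - V a x) / u a x) \<longlongrightarrow> q a) (at (ts a) within {0..<ts a})"
          by (rule tendsto_within_subset[OF lim]) (use t in auto)
        show "\<forall>\<^sub>F x in at (ts a) within {0..<ts a}. (Vfd x - V a x) / u a x \<le> (Vfd \<theta> - V a \<theta>) / u a \<theta>"
          using order 3 by (simp add: eventually_at_filter)
      qed (use at_within_side_nontrivial t in auto)
      moreover have "0 < u a \<theta>" using u_sign[OF aI \<theta>] 3 by auto
      ultimately show ?thesis by (simp add: field_simps)
    qed
  qed
  \<comment> \<open>At an extreme action \<open>ts a\<close> is an extreme state and one side is
    empty, so these actions are reached by continuity in \<open>a\<close>.\<close>
  have "0 \<le> Vfd \<theta> - V a \<theta> - q a * u a \<theta>"
  proof (rule continuous_ge_on_closure[where S = "{0<..<1}" and x = a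
        and f = "\<lambda>a. Vfd \<theta> - V a \<theta> - q a * u a \<theta>"])
    show "continuous_on (closure {0<..<1}) (\<lambda>a. Vfd \<theta> - V a \<theta> - q a * u a \<theta>)"
      using \<theta> by (auto intro!: continuous_intros V_cont' u_cont' q_continuous)
  qed (use a interior in auto)
  then show ?thesis by simp
qed

text \<open>The multiplier term vanishes at \<open>(act x, x)\<close>, which puts \<open>p\<close>
  above \<open>Vfd\<close>. A gap at one state would spread to an open set of positive mass and
  contradict minimality of \<open>p\<close> against the feasible \<open>Vfd\<close>.\<close>

lemma dual_solution_eq_Vfd:
  assumes opt: "optimal V u \<phi> (full_disclosure u \<phi>)" and dual: "dual_solution V u \<phi> p"
    and \<theta>: "\<theta> \<in> {0..1}"
  shows "p \<theta> = Vfd \<theta>"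
proof (rule ccontr)
  assume ne: "p \<theta> \<noteq> Vfd \<theta>"
  obtain q' where "dual_feasible V u p q'" using dual by (auto simp: dual_solution_def)
  then have cp: "continuous_on {0..1} p"
    and feas: "\<And>a \<theta>. a \<in> {0..1} \<Longrightarrow> \<theta> \<in> {0..1} \<Longrightarrow> V a \<theta> \<le> p \<theta> - q' a * u a \<theta>"
    by (auto simp: dual_feasible_def)
  have ge: "Vfd x \<le> p x" if "x \<in> {0..1}" for x
    using feas[OF act_mem[OF that] that] u_act[OF that] by (simp add: Vfd_def)
  have "dual_feasible V u Vfd q"
    unfolding dual_feasible_def
    using full_disclosure_price_feasible[OF opt] Vfd_continuous q_continuous
      continuous_measurable_Mtheta[OF q_continuous]
    by (auto intro!: compact_imp_bounded compact_continuous_image simp: algebra_simps)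
  then have le: "(\<integral>x. p x \<partial>\<phi>) \<le> (\<integral>x. Vfd x \<partial>\<phi>)" using dual by (auto simp: dual_solution_def)
  have cd: "continuous_on {0..1} (\<lambda>x. p x - Vfd x)" by (intro continuous_intros cp Vfd_continuous)
  define N where "N = {0..1} \<inter> (\<lambda>x. p x - Vfd x) -` {0<..}"
  have "openin (top_of_set {0..1}) N" "N \<noteq> {}"
    unfolding N_def using cd \<theta> ne ge[OF \<theta>] by (auto intro!: continuous_openin_preimage_gen)
  then have "0 < (\<integral>x. p x - Vfd x \<partial>\<phi>)"
    by (rule integral_pos_on_open[OF prior full_support _ _ integrable_Mtheta[OF prior cd]])
       (use ge in \<open>auto simp: N_def\<close>)
  then show False
    using le integrable_Mtheta[OF prior cp] integrable_Mtheta[OF prior Vfd_continuous] by simp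
qed

section \<open>Uniqueness\<close>

text \<open>The section at \<open>a\<close> contains \<open>ts a\<close> along with \<open>x\<close>
  and \<open>y\<close>. Lying strictly between them, \<open>ts a\<close> triggers no collapse in
  \<open>Gamma_star_sec\<close>, which then has at least three points.\<close>

lemma contact_one_sided:
  assumes opt: "optimal V u \<phi> (full_disclosure u \<phi>)" and dual: "dual_solution V u \<phi> p"
    and pairwise: "finite (Gamma_star_sec V u v ua p a)" "card (Gamma_star_sec V u v ua p a) \<le> 2"
    and a: "a \<in> {0..1}"
    and x: "x \<in> {0..1}" "Vfd x = V a x + q a * u a x" "x < ts a"
    and y: "y \<in> {0..1}" "Vfd y = V a y + q a * u a y" "ts a < y"
  shows False
proof -
  let ?G = "Gamma_sec V u v ua p a"
  have p: "p \<theta> = Vfd \<theta>" if "\<theta> \<in> {0..1}" for \<theta>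
    using dual_solution_eq_Vfd[OF opt dual that] .
  \<comment> \<open>This equality selects the first branch of \<open>qfun\<close>.\<close>
  have "p (ts a) = V a (ts a)" using p[OF ts_mem[OF a]] act_ts[OF a] by (simp add: Vfd_def)
  then have "qfun V u v ua p a = q a"
    using ts_mem[OF a] by (simp add: qfun_def q_def Let_def)
  then have G: "?G = {\<theta>\<in>{0..1}. Vfd \<theta> = V a \<theta> + q a * u a \<theta>}"
    using a p by (auto simp: Gamma_sec_def Gamma_def)
  have mem: "x \<in> ?G" "y \<in> ?G" "ts a \<in> ?G"
    using x y ts_mem[OF a] act_ts[OF a] u_ts[OF a] by (auto simp: G Vfd_def)
  have "bdd_below ?G" "bdd_above ?G" unfolding G by (auto intro: bdd_belowI bdd_aboveI)
  then have "Inf ?G < ts a" "ts a < Sup ?G"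
    using cInf_lower[OF mem(1)] cSup_upper[OF mem(2)] x(3) y(3) by auto
  then have "Gamma_star_sec V u v ua p a = ?G" by (auto simp: Gamma_star_sec_def Let_def)
  \<comment> \<open>Monotonicity of \<open>card\<close> relies on \<open>finite\<close>: an infinite
    set has cardinality 0 by convention.\<close>
  then have "card {x, ts a, y} \<le> 2"
    using card_mono[of ?G "{x, ts a, y}"] pairwise mem by auto
  then show False using x(3) y(3) by simp
qed

text \<open>Complementary slackness puts \<open>P\<close> on the zero set of \<open>s\<close>.
  Splitting actions by whether they have a contact state below \<open>ts a\<close> fixes the sign of
  \<open>u\<close> on each piece, and obedience on each piece forces \<open>u\<close> to
  vanish.\<close>

lemma full_disclosure_unique:
  assumes opt: "optimal V u \<phi> (full_disclosure u \<phi>)" and dual: "dual_solution V u \<phi> p"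
    and pairwise: "\<And>a. a \<in> {0..1} \<Longrightarrow> finite (Gamma_star_sec V u v ua p a) \<and>
      card (Gamma_star_sec V u v ua p a) \<le> 2"
    and optP: "optimal V u \<phi> P"
  shows "P = full_disclosure u \<phi>"
proof -
  have impl: "implementable u \<phi> P" using optP by (simp add: optimal_def)
  have prob: "prob_on P ({0..1} \<times> {0..1})" and marg: "distr P Mtheta snd = \<phi>"
    and obed: "\<And>A. A \<in> sets Mtheta \<Longrightarrow> (\<integral>x. indicator A (fst x) * u (fst x) (snd x) \<partial>P) = 0"
    using impl by (auto simp: implementable_iff)
  interpret prob_space P using prob by (simp add: prob_on_Mout)
  have setsP: "sets P = sets Mout" using prob by (simp add: prob_on_Mout)
  have spaceP: "space P = {0..1} \<times> {0..1}"
    using sets_eq_imp_space_eq[OF setsP] by (simp add: space_Mout)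
  have fst_P: "fst \<in> measurable P Mtheta" and snd_P: "snd \<in> measurable P Mtheta"
    using measurable_Mout_fst measurable_Mout_snd by (simp_all add: measurable_cong_sets[OF setsP refl])
  let ?u = "\<lambda>x. u (fst x) (snd x)" and ?V = "\<lambda>x. V (fst x) (snd x)"
  \<comment> \<open>The slack of the pair \<open>(Vfd, q)\<close> in the dual constraint; its zero
    set in the square is the contact set.\<close>
  define s where "s x = Vfd (snd x) - ?V x - q (fst x) * ?u x" for x
  note intg = integrable_Mout[OF prob]
  have cq: "continuous_on ({0..1} \<times> {0..1}) (\<lambda>x. q (fst x))"
    by (rule continuous_on_compose2[OF q_continuous]) (auto intro: continuous_intros)
  have cVfd: "continuous_on ({0..1} \<times> {0..1}) (\<lambda>x. Vfd (snd x))"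
    by (rule continuous_on_compose2[OF Vfd_continuous]) (auto intro: continuous_intros)
  have cu: "continuous_on ({0..1} \<times> {0..1}) ?u" and cV: "continuous_on ({0..1} \<times> {0..1}) ?V"
    by (intro u_cont' V_cont' continuous_intros; auto)+
  have cs: "continuous_on ({0..1} \<times> {0..1}) s"
    unfolding s_def by (intro continuous_intros cq cVfd cu cV)

  \<comment> \<open>The integral of \<open>s\<close> is the duality gap: the \<open>q\<close> term
    vanishes by obedience, the price term depends only on the state marginal, and both outcomes
    attain the same value.\<close>
  have "(\<integral>x. q (fst x) * ?u x \<partial>P) = 0"
    by (rule integral_mult_eq_0[OF finite_measure_axioms fst_P intg[OF cu] obed
          continuous_measurable_Mtheta[OF q_continuous] intg[OF continuous_on_mult[OF cq cu]]])
  moreover have "(\<integral>x. Vfd (snd x) \<partial>P) = (\<integral>\<theta>. Vfd \<theta> \<partial>\<phi>)"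
    unfolding marg[symmetric]
    by (rule integral_distr[symmetric, OF snd_P continuous_measurable_Mtheta[OF Vfd_continuous]])
  moreover have "(\<integral>x. ?V x \<partial>P) = (\<integral>\<theta>. Vfd \<theta> \<partial>\<phi>)"
    using opt optP integral_full_disclosure unfolding optimal_def by (metis antisym)
  ultimately have "(\<integral>x. s x \<partial>P) = 0"
    unfolding s_def
    using intg[OF cVfd] intg[OF cV] intg[OF continuous_on_mult[OF cq cu]] by simp
  moreover have "AE x in P. 0 \<le> s x"
    using full_disclosure_price_feasible[OF opt] spaceP by (auto simp: s_def algebra_simps)
  ultimately have contact: "AE x in P. s x = 0"
    using integral_nonneg_eq_0_iff_AE[OF intg[OF cs]] by simp

  text \<open>A countable union of compact sets, because projections of Borel sets need not be Borel.\<close>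
  define K where "K n = ({0..1} \<times> {0..1}) \<inter>
    (\<lambda>x. (s x, ts (fst x) - snd x)) -` ({0} \<times> {1 / real (Suc n)..})" for n
  have "compact (K n)" for n
  proof -
    have "continuous_on ({0..1} \<times> {0..1}) (\<lambda>x::real \<times> real. ts (fst x))"
      by (rule continuous_on_compose2[OF ts_continuous]) (auto intro: continuous_intros)
    then have "continuous_on ({0..1} \<times> {0..1}) (\<lambda>x. (s x, ts (fst x) - snd x))"
      by (intro continuous_on_Pair cs continuous_on_diff continuous_on_snd continuous_on_id)
    then have "closed (K n)"
      unfolding K_def by (rule continuous_closed_preimage) (intro closed_Times; simp)+
    moreover have "K n = ({0..1} \<times> {0..1}) \<inter> K n" by (auto simp: K_def)
    ultimately show ?thesis by (metis compact_Int_closed compact_Times compact_Icc)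
  qed
  then have "compact (fst ` K n)" for n by (intro compact_continuous_image continuous_intros)
  then have Kn: "fst ` K n \<in> sets Mtheta" for n
    using compact_imp_closed[of "fst ` K n"]
    by (auto simp: Mtheta_def sets_restrict_space_iff K_def intro!: borel_closed)
  define B where "B = (\<Union>n. fst ` K n)"
  have B: "B \<in> sets Mtheta" unfolding B_def using Kn by auto
  have B_iff: "a \<in> B \<longleftrightarrow> (\<exists>\<theta>\<in>{0..1}. s (a, \<theta>) = 0 \<and> \<theta> < ts a)" if a: "a \<in> {0..1}" for a
  proof
    assume "a \<in> B"
    then obtain n \<theta> where "(a, \<theta>) \<in> K n" by (auto simp: B_def)
    then have "\<theta> \<in> {0..1}" "s (a, \<theta>) = 0" "1 / real (Suc n) \<le> ts a - \<theta>"
      by (auto simp: K_def)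
    moreover have "0 < 1 / real (Suc n)" by simp
    ultimately have "\<theta> < ts a" by linarith
    then show "\<exists>\<theta>\<in>{0..1}. s (a, \<theta>) = 0 \<and> \<theta> < ts a"
      using \<open>\<theta> \<in> {0..1}\<close> \<open>s (a, \<theta>) = 0\<close> by blast
  next
    assume "\<exists>\<theta>\<in>{0..1}. s (a, \<theta>) = 0 \<and> \<theta> < ts a"
    then obtain \<theta> where \<theta>: "\<theta> \<in> {0..1}" "s (a, \<theta>) = 0" "\<theta> < ts a" by blast
    obtain n where "1 / real (Suc n) < ts a - \<theta>"
      using reals_Archimedean[of "ts a - \<theta>"] \<theta>(3) by (auto simp: inverse_eq_divide)
    then have "(a, \<theta>) \<in> K n" using a \<theta> by (auto simp: K_def)
    then show "a \<in> B" by (force simp: B_def)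
  qed
  \<comment> \<open>On \<open>B\<close> some contact state lies below \<open>ts\<close>, so
    \<open>contact_one_sided\<close> excludes contact above it.\<close>
  have in_B: "?u x \<le> 0" if x: "x \<in> space P" "s x = 0" "fst x \<in> B" for x
  proof (rule ccontr)
    assume *: "\<not> ?u x \<le> 0"
    have xI: "fst x \<in> {0..1}" "snd x \<in> {0..1}" using x spaceP by auto
    obtain \<theta> where "\<theta> \<in> {0..1}" "s (fst x, \<theta>) = 0" "\<theta> < ts (fst x)"
      using B_iff[OF xI(1)] x(3) by blast
    then show False
      using contact_one_sided[OF opt dual _ _ xI(1), of \<theta> "snd x"] pairwise[OF xI(1)] xI x(2) *
        u_sign(1)[OF xI]
      by (auto simp: s_def not_le)
  qed
  \<comment> \<open>Off \<open>B\<close> no contact state lies below \<open>ts\<close>, by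
    \<open>B_iff\<close>.\<close>
  have not_B: "0 \<le> ?u x" if "x \<in> space P" "s x = 0" "fst x \<notin> B" for x
  proof (rule ccontr)
    assume *: "\<not> 0 \<le> ?u x"
    have xI: "fst x \<in> {0..1}" "snd x \<in> {0..1}" using that spaceP by auto
    show False using B_iff[OF xI(1)] that xI u_sign(2)[OF xI] * by (metis not_le prod.collapse)
  qed
  have intA: "integrable P (\<lambda>x. indicator A (fst x) * ?u x)" if A: "A \<in> sets Mtheta" for A
  proof (rule Bochner_Integration.integrable_bound[OF intg[OF cu]])
    show "(\<lambda>x. indicator A (fst x) * ?u x) \<in> borel_measurable P"
      using fst_P A borel_measurable_integrable[OF intg[OF cu]] by measurable
  qed (auto simp: indicator_def)
  have B': "{0..1} - B \<in> sets Mtheta" using B sets.compl_sets[of B Mtheta] by (simp add: space_Mtheta)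
  \<comment> \<open>Both this integrand and the next are nonnegative almost everywhere and integrate
    to zero by obedience, hence vanish almost everywhere.\<close>
  have "AE x in P. indicator B (fst x) * - ?u x = 0"
  proof (subst integral_nonneg_eq_0_iff_AE[symmetric])
    show "AE x in P. 0 \<le> indicator B (fst x) * - ?u x"
      using contact AE_space by eventually_elim (use in_B in \<open>auto simp: indicator_def\<close>)
  qed (use intA[OF B] obed[OF B] in simp_all)
  moreover have "AE x in P. indicator ({0..1} - B) (fst x) * ?u x = 0"
  proof (subst integral_nonneg_eq_0_iff_AE[symmetric])
    show "AE x in P. 0 \<le> indicator ({0..1} - B) (fst x) * ?u x"
      using contact AE_space by eventually_elim (use not_B in \<open>auto simp: indicator_def\<close>)
  qed (use intA[OF B'] obed[OF B'] in simp_all)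
  ultimately have "AE x in P. x = (act (snd x), snd x)"
    using AE_space
  proof eventually_elim
    case (elim x)
    then have xI: "fst x \<in> {0..1}" "snd x \<in> {0..1}" using spaceP by auto
    have "?u x = 0" using elim xI by (auto simp: indicator_def split: if_splits)
    then show ?case using u_eq_0_iff[OF xI] by (simp add: prod_eq_iff)
  qed
  \<comment> \<open>Maps that agree almost everywhere push \<open>P\<close> to the same measure, and
    \<open>snd\<close> carries \<open>P\<close> to the prior, so the right-hand side is the
    disclosure of \<open>\<phi>\<close>.\<close>
  then have "distr P Mout (\<lambda>x. x) = distr P Mout (\<lambda>x. (act (snd x), snd x))"
    using measurable_compose[OF snd_P measurable_act]
    by (intro distr_cong_AE) (auto simp: measurable_ident_sets[OF setsP])
  also have "\<dots> = distr (distr P Mtheta snd) Mout (\<lambda>\<theta>. (act \<theta>, \<theta>))"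
    by (simp add: distr_distr[OF measurable_act snd_P] comp_def)
  also have "\<dots> = full_disclosure u \<phi>"
    unfolding marg full_disclosure_def act_def ..
  finally show ?thesis using distr_id2[OF setsP[symmetric]] by simp
qed

end

theorem theorem6:
  fixes V U v u ua :: "real \<Rightarrow> real \<Rightarrow> real"
    and \<phi> :: "real measure"
    and p :: "real \<Rightarrow> real"
  assumes prior: "prob_on \<phi> {0..1}"
    and Theta_full: "supp \<phi> = {0..1}"
    and V_cont: "continuous_on ({0..1} \<times> {0..1}) (\<lambda>(a, \<theta>). V a \<theta>)"
    and U_cont: "continuous_on ({0..1} \<times> {0..1}) (\<lambda>(a, \<theta>). U a \<theta>)"
    and A1_V: "\<forall>a\<in>{0..1}. \<forall>\<theta>\<in>{0..1}. ((\<lambda>b. V b \<theta>) has_real_derivative v a \<theta>) (at a within {0..1})"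
    and A1_U: "\<forall>a\<in>{0..1}. \<forall>\<theta>\<in>{0..1}. ((\<lambda>b. U b \<theta>) has_real_derivative u a \<theta>) (at a within {0..1})"
    and A1_u: "\<forall>a\<in>{0..1}. \<forall>\<theta>\<in>{0..1}. ((\<lambda>b. u b \<theta>) has_real_derivative ua a \<theta>) (at a within {0..1})"
    and A1_v_cont: "continuous_on ({0..1} \<times> {0..1}) (\<lambda>(a, \<theta>). v a \<theta>)"
    and A1_u_cont: "continuous_on ({0..1} \<times> {0..1}) (\<lambda>(a, \<theta>). u a \<theta>)"
    and A1_ua_cont: "continuous_on ({0..1} \<times> {0..1}) (\<lambda>(a, \<theta>). ua a \<theta>)"
    and A2: "\<forall>a\<in>{0..1}. \<forall>\<mu>. prob_on \<mu> {0..1} \<longrightarrow>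
               (\<integral>\<theta>. u a \<theta> \<partial>\<mu>) = 0 \<longrightarrow> (\<integral>\<theta>. ua a \<theta> \<partial>\<mu>) < 0"
    and A3_min: "(\<forall>\<theta>\<in>{0..1}. 0 \<le> u 0 \<theta>) \<and> (\<exists>\<theta>\<in>{0..1}. u 0 \<theta> = 0)"
    and A3_max: "(\<forall>\<theta>\<in>{0..1}. u 1 \<theta> \<le> 0) \<and> (\<exists>\<theta>\<in>{0..1}. u 1 \<theta> = 0)"
    and A4: "\<forall>a\<in>{0..1}. \<forall>\<theta>\<in>{0..1}. \<forall>\<theta>'\<in>{0..1}.
               \<theta> < \<theta>' \<longrightarrow> u a \<theta> = 0 \<longrightarrow> u a \<theta>' > 0"
    and dual: "dual_solution V u \<phi> p"
    and pairwise: "\<forall>a\<in>{0..1}. finite (Gamma_star_sec V u v ua p a) \<and>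
                                card (Gamma_star_sec V u v ua p a) \<le> 2"
    and fd_opt: "optimal V u \<phi> (full_disclosure u \<phi>)"
  shows "\<forall>\<pi>. optimal V u \<phi> \<pi> \<longrightarrow> \<pi> = full_disclosure u \<phi>"
proof -
  \<comment> \<open>Assumption 2 is applied at the point mass \<open>return Mtheta \<theta>\<close>,
    where both integrals are values at \<open>\<theta>\<close>.\<close>
  have neg: "ua a \<theta> < 0" if a: "a \<in> {0..1}" and \<theta>: "\<theta> \<in> {0..1}" and 0: "u a \<theta> = 0" for a \<theta>
  proof -
    have "continuous_on {0..1} (u a)" "continuous_on {0..1} (ua a)"
      using a by (auto intro!: continuous_on_square_section[OF A1_u_cont]
          continuous_on_square_section[OF A1_ua_cont] continuous_intros)
    then show ?thesis
      using A2 a 0 return_prob_on[OF \<theta>] integral_return_Mtheta[OF \<theta>] by metis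
  qed
  interpret persuasion u ua V v \<phi>
    by (unfold_locales;
        use A1_u A1_u_cont A1_ua_cont neg A3_min A3_max A4 A1_V V_cont A1_v_cont prior Theta_full in blast)
  show ?thesis
    using full_disclosure_unique[OF fd_opt dual] pairwise by blast
qed

end
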